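(* Let $Q$ be a probability measure on $\Psi$ that is absolutely continuous with respect to $\nu_\Psi$, and let $\psi_0\in\Psi$. The Gâteaux derivative of the strength $\Pi_\Psi(RB_\Psi(\psi\,|\,x)\le RB_\Psi(\psi_0\,|\,x)\,|\,x)$ at $\psi_0$ in the direction $Q$ (perturbing the marginal prior of $\psi$), i.e. the limit as $\epsilon\to0$ of $$\frac{\Pi_{\epsilon,\Psi}(RB_{\epsilon,\Psi}(\psi\,|\,x)\le RB_{\epsilon,\Psi}(\psi_0\,|\,x)\,|\,x)-\Pi_\Psi(RB_\Psi(\psi\,|\,x)\le RB_\Psi(\psi_0\,|\,x)\,|\,x)}{\epsilon},$$ is $$\frac{m_Q(x)}{m(x)}\Big\{Q(RB_\Psi(\psi\,|\,x)\le RB_\Psi(\psi_0\,|\,x)\,|\,x)-\Pi_\Psi(RB_\Psi(\psi\,|\,x)\le RB_\Psi(\psi_0\,|\,x)\,|\,x)\Big\}.$$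
   Context: Setting. $\{f_\theta:\theta\in\Theta\}$ is a statistical model of probability densities with respect to volume measure $\mu$ on a sample space $\mathcal X$ (volume measure on a discrete set is counting measure); $x$ is the observed data. $\Pi$ is a proper prior on $\Theta$ with density $\pi$ with respect to volume measure $\nu$. $\Psi:\Theta\to\Psi$ is an onto map (same symbol for map and range), $\psi=\Psi(\theta)$, $\Pi_\Psi$ is the marginal prior of $\psi$ with density $\pi_\Psi$ with respect to a support measure $\nu_\Psi$ on $\Psi$, and $\Pi(\cdot\,|\,\psi)$ is the conditional prior of $\theta$ given $\Psi(\theta)=\psi$, concentrated on $\Psi^{-1}\{\psi\}$. The conditional prior predictive density is $m(x\,|\,\psi)=\int_{\Psi^{-1}\{\psi\}}f_\theta(x)\,\Pi(d\theta\,|\,\psi)$ and the prior predictive density is $m(x)=\int_\Psi m(x\,|\,\psi)\,\Pi_\Psi(d\psi)$, with $m(x)>0$. The posterior of $\psi$ is $\Pi_\Psi(A\,|\,x)=\int_A(m(x\,|\,\psi)/m(x))\,\Pi_\Psi(d\psi)$, and the relative belief ratio is $RB_\Psi(\psi\,|\,x)=m(x\,|\,\psi)/m(x)$. Perturbed prior: $\Pi_\epsilon$ is the prior on $\theta$ with marginal $(1-\epsilon)\Pi_\Psi+\epsilon Q$ for $\psi$ and unchanged conditional priors $\Pi(\cdot\,|\,\psi)$. Put $m_Q(x)=\int_\Psi m(x\,|\,\psi)\,Q(d\psi)$ and $Q(A\,|\,x)=\int_A(m(x\,|\,\psi)/m_Q(x))\,Q(d\psi)$. The posterior of $\psi$ based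 on $\Pi_\epsilon$ is $\Pi_{\epsilon,\Psi}(\cdot\,|\,x)=(1-\epsilon_x)\Pi_\Psi(\cdot\,|\,x)+\epsilon_xQ(\cdot\,|\,x)$ with $\epsilon_x=\epsilon m_Q(x)/[(1-\epsilon)m(x)+\epsilon m_Q(x)]$, and the relative belief ratio based on $\Pi_\epsilon$ is $RB_{\epsilon,\Psi}(\psi\,|\,x)=m(x\,|\,\psi)/\{(1-\epsilon)m(x)+\epsilon m_Q(x)\}$. In probabilities such as $\Pi_\Psi(RB_\Psi(\psi\,|\,x)\le RB_\Psi(\psi_0\,|\,x)\,|\,x)$, $\psi$ is the random quantity and $\psi_0$ is fixed. *)

theory Defs
  imports "HOL-Probability.Probability"
begin

text \<open>
  The \<sigma>-algebras on the sample space, the parameter space and the range of \<open>\<Psi>\<close> are those carried by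
  the measures \<open>\<mu>\<close>, \<open>\<nu>\<close> and \<open>\<nu>\<^sub>\<Psi>\<close>, so that for instance the parameter space is \<open>space \<nu>\<close>.
  The conditional priors form a Markov kernel \<open>K\<close>, with \<open>K \<psi>\<close> the conditional prior of \<open>\<theta>\<close>
  given \<open>\<Psi> \<theta> = \<psi>\<close>. It is defined at every \<open>\<psi>\<close>, not only almost everywhere with respect to the
  marginal prior, because it also enters integrals with respect to other distributions of \<open>\<psi>\<close>.
\<close>

definition prior :: "'t measure \<Rightarrow> ('t \<Rightarrow> real) \<Rightarrow> 't measure" where
  "prior \<nu> \<pi> = density \<nu> (\<lambda>\<theta>. ennreal (\<pi> \<theta>))"

definition marginal :: "('t \<Rightarrow> 'p) \<Rightarrow> 'p measure \<Rightarrow> 't measure \<Rightarrow> 'p measure" where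
  "marginal \<Psi> \<nu>\<^sub>\<Psi> P = distr P \<nu>\<^sub>\<Psi> \<Psi>"

locale bayes_model =
  fixes \<mu> :: "'x measure" and f :: "'t \<Rightarrow> 'x \<Rightarrow> real"
    and \<nu> :: "'t measure" and \<pi> :: "'t \<Rightarrow> real"
    and \<Psi> :: "'t \<Rightarrow> 'p" and \<nu>\<^sub>\<Psi> :: "'p measure" and \<pi>\<^sub>\<Psi> :: "'p \<Rightarrow> real"
    and K :: "'p \<Rightarrow> 't measure"
  assumes f_nonneg: "\<And>\<theta> x. \<theta> \<in> space \<nu> \<Longrightarrow> x \<in> space \<mu> \<Longrightarrow> 0 \<le> f \<theta> x"
    and f_measurable: "\<And>\<theta>. \<theta> \<in> space \<nu> \<Longrightarrow> f \<theta> \<in> borel_measurable \<mu>"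
    and f_measurable_param: "\<And>x. x \<in> space \<mu> \<Longrightarrow> (\<lambda>\<theta>. f \<theta> x) \<in> borel_measurable \<nu>"
    and f_density: "\<And>\<theta>. \<theta> \<in> space \<nu> \<Longrightarrow> prob_space (density \<mu> (\<lambda>x. ennreal (f \<theta> x)))"
    and \<pi>_nonneg: "\<And>\<theta>. \<theta> \<in> space \<nu> \<Longrightarrow> 0 \<le> \<pi> \<theta>"
    and \<pi>_measurable: "\<pi> \<in> borel_measurable \<nu>"
    and prior_proper: "prob_space (prior \<nu> \<pi>)"
    and \<Psi>_measurable: "\<Psi> \<in> measurable \<nu> \<nu>\<^sub>\<Psi>"
    and \<Psi>_onto: "\<Psi> ` space \<nu> = space \<nu>\<^sub>\<Psi>"
    and \<pi>\<^sub>\<Psi>_nonneg: "\<And>\<psi>. \<psi> \<in> space \<nu>\<^sub>\<Psi> \<Longrightarrow> 0 \<le> \<pi>\<^sub>\<Psi> \<psi>"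
    and \<pi>\<^sub>\<Psi>_measurable: "\<pi>\<^sub>\<Psi> \<in> borel_measurable \<nu>\<^sub>\<Psi>"
    and marginal_density: "marginal \<Psi> \<nu>\<^sub>\<Psi> (prior \<nu> \<pi>) = density \<nu>\<^sub>\<Psi> (\<lambda>\<psi>. ennreal (\<pi>\<^sub>\<Psi> \<psi>))"
    and K_kernel: "K \<in> measurable \<nu>\<^sub>\<Psi> (prob_algebra \<nu>)"
    and K_concentrated: "\<And>\<psi>. \<psi> \<in> space \<nu>\<^sub>\<Psi> \<Longrightarrow> AE \<theta> in K \<psi>. \<Psi> \<theta> = \<psi>"
    and K_disintegration: "prior \<nu> \<pi> = marginal \<Psi> \<nu>\<^sub>\<Psi> (prior \<nu> \<pi>) \<bind> K"

text \<open>
  Below, \<open>P\<close> is a distribution on the range of \<open>\<Psi>\<close> that serves as (marginal) prior of \<open>\<psi>\<close>; the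
  notions for the original prior, for the perturbed prior and for \<open>Q\<close> are obtained by
  varying \<open>P\<close>. As \<open>K \<psi>\<close> is concentrated on the fibre of \<open>\<Psi>\<close> over \<open>\<psi>\<close>, integrals over this fibre
  are written as integrals over the whole parameter space.
\<close>

definition cond_predictive :: "('t \<Rightarrow> 'x \<Rightarrow> real) \<Rightarrow> ('p \<Rightarrow> 't measure) \<Rightarrow> 'x \<Rightarrow> 'p \<Rightarrow> ennreal" where
  "cond_predictive f K x \<psi> = (\<integral>\<^sup>+ \<theta>. ennreal (f \<theta> x) \<partial>K \<psi>)"

definition predictive :: "('t \<Rightarrow> 'x \<Rightarrow> real) \<Rightarrow> ('p \<Rightarrow> 't measure) \<Rightarrow> 'p measure \<Rightarrow> 'x \<Rightarrow> ennreal" where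
  "predictive f K P x = (\<integral>\<^sup>+ \<psi>. cond_predictive f K x \<psi> \<partial>P)"

definition posterior ::
  "('t \<Rightarrow> 'x \<Rightarrow> real) \<Rightarrow> ('p \<Rightarrow> 't measure) \<Rightarrow> 'p measure \<Rightarrow> 'x \<Rightarrow> 'p measure" where
  "posterior f K P x = density P (\<lambda>\<psi>. cond_predictive f K x \<psi> / predictive f K P x)"

definition relative_belief ::
  "('t \<Rightarrow> 'x \<Rightarrow> real) \<Rightarrow> ('p \<Rightarrow> 't measure) \<Rightarrow> 'p measure \<Rightarrow> 'x \<Rightarrow> 'p \<Rightarrow> ennreal" where
  "relative_belief f K P x \<psi> = cond_predictive f K x \<psi> / predictive f K P x"

definition rb_event ::
  "('t \<Rightarrow> 'x \<Rightarrow> real) \<Rightarrow> ('p \<Rightarrow> 't measure) \<Rightarrow> 'p measure \<Rightarrow> 'x \<Rightarrow> 'p \<Rightarrow> 'p set" where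
  "rb_event f K P x \<psi>\<^sub>0 =
     {\<psi> \<in> space P. relative_belief f K P x \<psi> \<le> relative_belief f K P x \<psi>\<^sub>0}"

definition strength ::
  "('t \<Rightarrow> 'x \<Rightarrow> real) \<Rightarrow> ('p \<Rightarrow> 't measure) \<Rightarrow> 'p measure \<Rightarrow> 'x \<Rightarrow> 'p \<Rightarrow> real" where
  "strength f K P x \<psi>\<^sub>0 = measure (posterior f K P x) (rb_event f K P x \<psi>\<^sub>0)"

text \<open>The mixture \<open>(1 - \<epsilon>) P + \<epsilon> Q\<close> is a measure only for \<open>0 \<le> \<epsilon> \<le> 1\<close> in general.\<close>

definition mixture :: "real \<Rightarrow> 'p measure \<Rightarrow> 'p measure \<Rightarrow> 'p measure" where
  "mixture \<epsilon> P Q = measure_of (space P) (sets P)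
     (\<lambda>A. ennreal (1 - \<epsilon>) * emeasure P A + ennreal \<epsilon> * emeasure Q A)"

text \<open>
  The perturbed prior lives on the parameter space: its marginal is the mixture, its conditional
  priors are unchanged (\<open>marginal_perturbed_prior\<close> below).
\<close>

definition perturbed_prior ::
  "('t \<Rightarrow> 'p) \<Rightarrow> 'p measure \<Rightarrow> ('p \<Rightarrow> 't measure) \<Rightarrow> 't measure \<Rightarrow> 'p measure \<Rightarrow> real \<Rightarrow> 't measure"
where
  "perturbed_prior \<Psi> \<nu>\<^sub>\<Psi> K P Q \<epsilon> = mixture \<epsilon> (marginal \<Psi> \<nu>\<^sub>\<Psi> P) Q \<bind> K"

lemma space_mixture [simp]: "space (mixture \<epsilon> P Q) = space P"
  and sets_mixture [simp, measurable_cong]: "sets (mixture \<epsilon> P Q) = sets P"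
  by (simp_all add: mixture_def)

lemma emeasure_mixture:
  assumes "sets Q = sets P" "A \<in> sets P"
  shows "emeasure (mixture \<epsilon> P Q) A = ennreal (1 - \<epsilon>) * emeasure P A + ennreal \<epsilon> * emeasure Q A"
  unfolding mixture_def
proof (rule emeasure_measure_of_sigma)
  show "sigma_algebra (space P) (sets P)" by (rule sets.sigma_algebra_axioms)
  show "positive (sets P) (\<lambda>A. ennreal (1 - \<epsilon>) * emeasure P A + ennreal \<epsilon> * emeasure Q A)"
    by (simp add: positive_def)
  show "countably_additive (sets P) (\<lambda>A. ennreal (1 - \<epsilon>) * emeasure P A + ennreal \<epsilon> * emeasure Q A)"
    using assms by (auto simp: countably_additive_def suminf_emeasure suminf_add[symmetric])
qed (use assms in auto)

lemma nn_integral_mixture: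
  assumes "sets Q = sets P" "g \<in> borel_measurable P"
  shows "(\<integral>\<^sup>+ \<psi>. g \<psi> \<partial>mixture \<epsilon> P Q)
    = ennreal (1 - \<epsilon>) * (\<integral>\<^sup>+ \<psi>. g \<psi> \<partial>P) + ennreal \<epsilon> * (\<integral>\<^sup>+ \<psi>. g \<psi> \<partial>Q)"
  using assms(2)
proof induction
  case (cong g h)
  have "integral\<^sup>N M g = integral\<^sup>N M h" if "space M = space P" for M
    using that cong by (intro nn_integral_cong) simp
  then show ?case using cong sets_eq_imp_space_eq[OF assms(1)] by simp
next
  case (set A)
  then show ?case using assms(1) by (simp add: emeasure_mixture)
next
  case (mult g c)
  moreover have "g \<in> borel_measurable Q" "g \<in> borel_measurable (mixture \<epsilon> P Q)"
    using mult assms(1) by (simp_all cong: measurable_cong_sets)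
  ultimately show ?case by (simp add: nn_integral_cmult algebra_simps)
next
  case (add g h)
  moreover have "g \<in> borel_measurable Q" "g \<in> borel_measurable (mixture \<epsilon> P Q)"
     "h \<in> borel_measurable Q" "h \<in> borel_measurable (mixture \<epsilon> P Q)"
    using add assms(1) by (simp_all cong: measurable_cong_sets)
  ultimately show ?case by (simp add: nn_integral_add algebra_simps)
next
  case (seq U)
  have m: "\<And>i. U i \<in> borel_measurable Q" "\<And>i. U i \<in> borel_measurable (mixture \<epsilon> P Q)"
    using seq assms(1) by (simp_all cong: measurable_cong_sets)
  have *: "incseq (\<lambda>i. \<integral>\<^sup>+ \<psi>. U i \<psi> \<partial>M)" for M
    using seq by (auto simp: incseq_def le_fun_def intro!: nn_integral_mono)
  show ?case
    using seq m * by (simp add: nn_integral_monotone_convergence_SUP image_comp SUP_mult_left_ennreal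
        ennreal_SUP_add[symmetric] incseq_def mult_left_mono)
qed

context bayes_model
begin

lemma marginal_perturbed_prior:
  assumes "prob_space Q" "sets Q = sets \<nu>\<^sub>\<Psi>" "0 \<le> \<epsilon>" "\<epsilon> \<le> 1"
  shows "marginal \<Psi> \<nu>\<^sub>\<Psi> (perturbed_prior \<Psi> \<nu>\<^sub>\<Psi> K (prior \<nu> \<pi>) Q \<epsilon>)
    = mixture \<epsilon> (marginal \<Psi> \<nu>\<^sub>\<Psi> (prior \<nu> \<pi>)) Q"
proof -
  let ?M = "mixture \<epsilon> (marginal \<Psi> \<nu>\<^sub>\<Psi> (prior \<nu> \<pi>)) Q"
  have sp: "space ?M = space \<nu>\<^sub>\<Psi>" "sets ?M = sets \<nu>\<^sub>\<Psi>" by (simp_all add: marginal_def)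
  have "space (prior \<nu> \<pi>) \<noteq> {}" using prior_proper by (rule prob_space.not_empty)
  then have "space \<nu> \<noteq> {}" by (simp add: prior_def)
  then have ne: "space ?M \<noteq> {}" using \<Psi>_onto sp by auto
  have K: "K \<in> measurable ?M (subprob_algebra \<nu>)"
    using measurable_prob_algebraD[OF K_kernel] sp by (simp cong: measurable_cong_sets)
  have "marginal \<Psi> \<nu>\<^sub>\<Psi> (?M \<bind> K) = ?M \<bind> (\<lambda>\<psi>. distr (K \<psi>) \<nu>\<^sub>\<Psi> \<Psi>)"
    unfolding marginal_def using distr_bind[OF K _ \<Psi>_measurable] ne by (simp add: marginal_def)
  also have "\<dots> = ?M \<bind> return \<nu>\<^sub>\<Psi>"
  proof (rule bind_cong[OF refl])
    fix \<psi> assume "\<psi> \<in> space ?M"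
    then have \<psi>: "\<psi> \<in> space \<nu>\<^sub>\<Psi>" using sp by simp
    from measurable_space[OF K_kernel \<psi>]
    have "sets (K \<psi>) = sets \<nu>" "prob_space (K \<psi>)" by (auto simp: space_prob_algebra)
    interpret k: prob_space "K \<psi>" by fact
    have \<Psi>': "\<Psi> \<in> measurable (K \<psi>) \<nu>\<^sub>\<Psi>"
      using \<Psi>_measurable \<open>sets (K \<psi>) = sets \<nu>\<close> by (simp cong: measurable_cong_sets)
    have "distr (K \<psi>) \<nu>\<^sub>\<Psi> \<Psi> = distr (K \<psi>) \<nu>\<^sub>\<Psi> (\<lambda>_. \<psi>)"
      using K_concentrated[OF \<psi>] \<Psi>' \<psi> by (intro distr_cong_AE) auto
    also have "\<dots> = return \<nu>\<^sub>\<Psi> \<psi>" using \<psi> by (rule k.distr_const)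
    finally show "distr (K \<psi>) \<nu>\<^sub>\<Psi> \<Psi> = return \<nu>\<^sub>\<Psi> \<psi>" .
  qed
  also have "\<dots> = ?M" by (rule bind_return'') (simp add: marginal_def)
  finally show ?thesis unfolding perturbed_prior_def .
qed

end

end

theory Submission
  imports Defs
begin

text \<open>
  For a prior whose predictive density at \<open>x\<close> is positive and finite, the relative belief ratio is a
  positive constant multiple of \<open>m(x | \<psi>)\<close>. The event whose posterior probability is the strength is
  therefore \<open>{\<psi>. m(x | \<psi>) \<le> m(x | \<psi>\<^sub>0)}\<close>, whatever the prior of \<open>\<psi>\<close>: the perturbation moves the
  posterior, but not the event (\<open>rb_event_eq\<close>). The posterior in turn moves along a segment:
  the perturbed one is \<open>(1 - \<epsilon>\<^sub>x) \<Pi>\<^sub>\<Psi>(\<cdot> | x) + \<epsilon>\<^sub>x Q(\<cdot> | x)\<close>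
  (\<open>posterior_mixture\<close>). For a fixed event \<open>A\<close> the difference quotient
  is thus exactly \<open>(\<epsilon>\<^sub>x / \<epsilon>) (Q(A | x) - \<Pi>\<^sub>\<Psi>(A | x))\<close>, where
  \<open>\<epsilon>\<^sub>x / \<epsilon> = m\<^sub>Q(x) / ((1 - \<epsilon>) m(x) + \<epsilon> m\<^sub>Q(x))\<close> tends to \<open>m\<^sub>Q(x) / m(x)\<close>.

  The one degenerate case is \<open>m\<^sub>Q(x) = 0\<close>, where \<open>Q(\<cdot> | x)\<close> is not a probability measure. It needs no
  separate limit, since \<open>Q(A | x)\<close> enters only through the product
  \<open>m\<^sub>Q(x) Q(A | x) = \<integral>\<^sub>A m(x | \<psi>) Q(d\<psi>)\<close>, which is valid there too (\<open>predictive_times_posterior\<close>).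
\<close>

lemma (in bayes_model) measurable_cond_predictive:
  assumes "x \<in> space \<mu>"
  shows "cond_predictive f K x \<in> borel_measurable \<nu>\<^sub>\<Psi>"
proof -
  have "(\<lambda>M. \<integral>\<^sup>+ \<theta>. ennreal (f \<theta> x) \<partial>M) \<in> borel_measurable (subprob_algebra \<nu>)"
    using f_measurable_param[OF assms] by (intro nn_integral_measurable_subprob_algebra) simp
  from measurable_compose[OF measurable_prob_algebraD[OF K_kernel] this]
  show ?thesis by (simp add: cond_predictive_def[abs_def])
qed

lemma rb_event_eq:
  assumes "0 < predictive f K P x" "predictive f K P x < \<infinity>"
  shows "rb_event f K P x \<psi>\<^sub>0
    = {\<psi> \<in> space P. cond_predictive f K x \<psi> \<le> cond_predictive f K x \<psi>\<^sub>0}"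
proof -
  let ?i = "inverse (predictive f K P x)"
  have i: "0 < ?i" "?i < top"
    using assms by (auto simp: ennreal_inverse_positive less_top[symmetric])
  have "a * ?i \<le> b * ?i \<longleftrightarrow> a \<le> b" for a b :: ennreal
    using ennreal_mult_strict_right_mono[of b a ?i] i mult_right_mono[of a b ?i]
    by (auto simp: not_le[symmetric])
  then show ?thesis
    by (simp add: rb_event_def relative_belief_def divide_ennreal_def)
qed

text \<open>
  Clearing the normalising constant makes the relation hold for \<open>m\<^sub>P(x) = 0\<close> as well: then
  \<open>m(x | \<psi>)\<close> vanishes \<open>P\<close>-almost everywhere.
\<close>

lemma predictive_times_posterior:
  assumes g: "cond_predictive f K x \<in> borel_measurable P" and A: "A \<in> sets P"
    and fin: "predictive f K P x < \<infinity>"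
  shows "enn2real (predictive f K P x) * measure (posterior f K P x) A
    = enn2real (\<integral>\<^sup>+ \<psi>. cond_predictive f K x \<psi> * indicator A \<psi> \<partial>P)" (is "_ = enn2real ?I")
proof -
  note [measurable] = g A
  let ?m = "predictive f K P x"
  have le: "?I \<le> ?m"
    unfolding predictive_def by (intro nn_integral_mono) (simp add: indicator_def)
  have "emeasure (posterior f K P x) A
      = (\<integral>\<^sup>+ \<psi>. cond_predictive f K x \<psi> * indicator A \<psi> * inverse ?m \<partial>P)"
    unfolding posterior_def divide_ennreal_def
    by (subst emeasure_density) (auto simp: mult_ac intro!: nn_integral_cong)
  also have "\<dots> = ?I * inverse ?m"
    by (rule nn_integral_multc) measurable
  finally have em: "emeasure (posterior f K P x) A = ?I * inverse ?m" .
  show ?thesis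
  proof (cases "?m = 0")
    case True
    then show ?thesis using le by simp
  next
    case False
    then have "?m * (?I * inverse ?m) = ?I"
      using fin ennreal_mult_divide_eq[of ?m ?I] by (simp add: divide_ennreal_def mult_ac)
    then show ?thesis
      unfolding measure_def em enn2real_mult[symmetric] by simp
  qed
qed

lemma predictive_mixture:
  assumes "cond_predictive f K x \<in> borel_measurable P" "sets Q = sets P"
    and "predictive f K P x < \<infinity>" "predictive f K Q x < \<infinity>" "0 \<le> \<epsilon>" "\<epsilon> \<le> 1"
  shows "predictive f K (mixture \<epsilon> P Q) x
    = ennreal ((1 - \<epsilon>) * enn2real (predictive f K P x) + \<epsilon> * enn2real (predictive f K Q x))"
proof -
  have "predictive f K (mixture \<epsilon> P Q) x
      = ennreal (1 - \<epsilon>) * predictive f K P x + ennreal \<epsilon> * predictive f K Q x"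
    using assms(1,2) unfolding predictive_def by (intro nn_integral_mixture)
  then show ?thesis
    using assms(3-) by (simp add: ennreal_plus ennreal_mult)
qed

text \<open>
  The posterior of a mixture is the mixture of the posteriors, reweighted by how well each
  component predicts \<open>x\<close>: both sides are \<open>(1 - \<epsilon>) \<integral>\<^sub>A m(x | \<psi>) P(d\<psi>) + \<epsilon> \<integral>\<^sub>A m(x | \<psi>) Q(d\<psi>)\<close> after
  division by the predictive density of the mixture.
\<close>

lemma posterior_mixture:
  fixes \<epsilon> :: real
  assumes g: "cond_predictive f K x \<in> borel_measurable P" and Q: "sets Q = sets P"
    and P_fin: "predictive f K P x < \<infinity>" and Q_fin: "predictive f K Q x < \<infinity>"
    and \<epsilon>: "0 \<le> \<epsilon>" "\<epsilon> \<le> 1" and A: "A \<in> sets P"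
  defines "m \<equiv> enn2real (predictive f K P x)" and "m\<^sub>Q \<equiv> enn2real (predictive f K Q x)"
  defines "\<epsilon>\<^sub>x \<equiv> \<epsilon> * m\<^sub>Q / ((1 - \<epsilon>) * m + \<epsilon> * m\<^sub>Q)"
  assumes pos: "0 < (1 - \<epsilon>) * m + \<epsilon> * m\<^sub>Q"
  shows "measure (posterior f K (mixture \<epsilon> P Q) x) A
    = (1 - \<epsilon>\<^sub>x) * measure (posterior f K P x) A + \<epsilon>\<^sub>x * measure (posterior f K Q x) A"
proof -
  let ?g = "cond_predictive f K x" and ?M = "mixture \<epsilon> P Q"
  let ?c = "(1 - \<epsilon>) * m + \<epsilon> * m\<^sub>Q"
  let ?I = "\<lambda>N. \<integral>\<^sup>+ \<psi>. ?g \<psi> * indicator A \<psi> \<partial>N"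
  have gs: "?g \<in> borel_measurable Q" "?g \<in> borel_measurable ?M"
    using g Q by (simp_all cong: measurable_cong_sets)
  have fin: "?I N < \<infinity>" if "predictive f K N x < \<infinity>" for N
  proof -
    have "?I N \<le> predictive f K N x"
      unfolding predictive_def by (intro nn_integral_mono) (simp add: indicator_def)
    from le_less_trans[OF this that] show ?thesis .
  qed
  have M: "predictive f K ?M x = ennreal ?c"
    unfolding m_def m\<^sub>Q_def using g Q P_fin Q_fin \<epsilon> by (rule predictive_mixture)
  have "?I ?M = ennreal (1 - \<epsilon>) * ?I P + ennreal \<epsilon> * ?I Q"
    using g A Q by (intro nn_integral_mixture) auto
  then have "enn2real (?I ?M) = (1 - \<epsilon>) * enn2real (?I P) + \<epsilon> * enn2real (?I Q)"
    using fin[OF P_fin] fin[OF Q_fin] \<epsilon>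
    by (simp add: enn2real_plus enn2real_mult ennreal_mult_less_top)
  also have "\<dots> = (1 - \<epsilon>) * (m * measure (posterior f K P x) A)
      + \<epsilon> * (m\<^sub>Q * measure (posterior f K Q x) A)"
    using A Q predictive_times_posterior[OF g A P_fin] predictive_times_posterior[OF gs(1) _ Q_fin]
    by (simp add: m_def m\<^sub>Q_def)
  finally have "?c * measure (posterior f K ?M x) A = (1 - \<epsilon>) * m * measure (posterior f K P x) A
      + \<epsilon> * m\<^sub>Q * measure (posterior f K Q x) A"
    using predictive_times_posterior[OF gs(2), of A] A M pos by simp
  then have "measure (posterior f K ?M x) A
      = ((1 - \<epsilon>) * m * measure (posterior f K P x) A + \<epsilon> * m\<^sub>Q * measure (posterior f K Q x) A) / ?c"
    using pos by (simp add: eq_divide_eq mult.commute)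
  also have "\<dots> = (1 - \<epsilon>) * m / ?c * measure (posterior f K P x) A
      + \<epsilon>\<^sub>x * measure (posterior f K Q x) A"
    by (simp add: \<epsilon>\<^sub>x_def add_divide_distrib)
  also have "(1 - \<epsilon>) * m / ?c = 1 - \<epsilon>\<^sub>x"
    using pos by (simp add: \<epsilon>\<^sub>x_def field_simps)
  finally show ?thesis .
qed

theorem proposition4:
  fixes \<mu> :: "'x measure" and f :: "'t \<Rightarrow> 'x \<Rightarrow> real"
    and \<nu> :: "'t measure" and \<pi> :: "'t \<Rightarrow> real"
    and \<Psi> :: "'t \<Rightarrow> 'p" and \<nu>\<^sub>\<Psi> :: "'p measure" and \<pi>\<^sub>\<Psi> :: "'p \<Rightarrow> real"
    and K :: "'p \<Rightarrow> 't measure" and Q :: "'p measure" and x :: 'x and \<psi>\<^sub>0 :: 'p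
  defines "Pr \<equiv> prior \<nu> \<pi>"
  defines "Pr\<^sub>\<Psi> \<equiv> marginal \<Psi> \<nu>\<^sub>\<Psi> Pr"
  assumes "bayes_model \<mu> f \<nu> \<pi> \<Psi> \<nu>\<^sub>\<Psi> \<pi>\<^sub>\<Psi> K"
    and "x \<in> space \<mu>" and "\<psi>\<^sub>0 \<in> space \<nu>\<^sub>\<Psi>"
    and "0 < predictive f K Pr\<^sub>\<Psi> x" and "predictive f K Pr\<^sub>\<Psi> x < \<infinity>"
    and "prob_space Q" and "sets Q = sets \<nu>\<^sub>\<Psi>" and "absolutely_continuous \<nu>\<^sub>\<Psi> Q"
    and "predictive f K Q x < \<infinity>"
  shows "((\<lambda>\<epsilon>. (strength f K (marginal \<Psi> \<nu>\<^sub>\<Psi> (perturbed_prior \<Psi> \<nu>\<^sub>\<Psi> K Pr Q \<epsilon>)) x \<psi>\<^sub>0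
               - strength f K Pr\<^sub>\<Psi> x \<psi>\<^sub>0) / \<epsilon>)
          \<longlongrightarrow> enn2real (predictive f K Q x) / enn2real (predictive f K Pr\<^sub>\<Psi> x)
             * (measure (posterior f K Q x) (rb_event f K Pr\<^sub>\<Psi> x \<psi>\<^sub>0) - strength f K Pr\<^sub>\<Psi> x \<psi>\<^sub>0))
         (at_right 0)"
proof -
  interpret bayes_model \<mu> f \<nu> \<pi> \<Psi> \<nu>\<^sub>\<Psi> \<pi>\<^sub>\<Psi> K by fact
  define m where "m = enn2real (predictive f K Pr\<^sub>\<Psi> x)"
  define m\<^sub>Q where "m\<^sub>Q = enn2real (predictive f K Q x)"
  define A where "A = rb_event f K Pr\<^sub>\<Psi> x \<psi>\<^sub>0"
  define d where "d = measure (posterior f K Q x) A - measure (posterior f K Pr\<^sub>\<Psi> x) A"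
  have sets: "sets Pr\<^sub>\<Psi> = sets \<nu>\<^sub>\<Psi>" by (simp add: Pr\<^sub>\<Psi>_def marginal_def)
  have g [measurable]: "cond_predictive f K x \<in> borel_measurable Pr\<^sub>\<Psi>"
    using measurable_cond_predictive[OF \<open>x \<in> space \<mu>\<close>] sets by (simp cong: measurable_cong_sets)
  have A: "A = {\<psi> \<in> space Pr\<^sub>\<Psi>. cond_predictive f K x \<psi> \<le> cond_predictive f K x \<psi>\<^sub>0}"
    unfolding A_def using assms(6,7) by (rule rb_event_eq)
  then have A_sets: "A \<in> sets Pr\<^sub>\<Psi>" by simp
  have m: "0 < m" using assms(6,7) by (simp add: m_def enn2real_positive_iff)
  have m\<^sub>Q: "0 \<le> m\<^sub>Q" by (simp add: m\<^sub>Q_def)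

  have quotient: "(strength f K (marginal \<Psi> \<nu>\<^sub>\<Psi> (perturbed_prior \<Psi> \<nu>\<^sub>\<Psi> K Pr Q \<epsilon>)) x \<psi>\<^sub>0
      - strength f K Pr\<^sub>\<Psi> x \<psi>\<^sub>0) / \<epsilon> = m\<^sub>Q / ((1 - \<epsilon>) * m + \<epsilon> * m\<^sub>Q) * d"
    if \<epsilon>: "0 < \<epsilon>" "\<epsilon> < 1" for \<epsilon>
  proof -
    let ?M = "mixture \<epsilon> Pr\<^sub>\<Psi> Q"
    have c: "0 < (1 - \<epsilon>) * m + \<epsilon> * m\<^sub>Q"
      using \<epsilon> m m\<^sub>Q by (intro add_pos_nonneg) auto
    have marginal: "marginal \<Psi> \<nu>\<^sub>\<Psi> (perturbed_prior \<Psi> \<nu>\<^sub>\<Psi> K Pr Q \<epsilon>) = ?M"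
      unfolding Pr\<^sub>\<Psi>_def Pr_def using assms(8,9) \<epsilon> by (intro marginal_perturbed_prior) auto
    have "predictive f K ?M x = ennreal ((1 - \<epsilon>) * m + \<epsilon> * m\<^sub>Q)"
      unfolding m_def m\<^sub>Q_def using g assms(7,9,11) sets \<epsilon> by (intro predictive_mixture) auto
    then have "rb_event f K ?M x \<psi>\<^sub>0 = A"
      using c by (subst rb_event_eq) (auto simp: A)
    then have "strength f K ?M x \<psi>\<^sub>0 = measure (posterior f K ?M x) A"
      by (simp add: strength_def)
    also have "\<dots> = (1 - \<epsilon> * m\<^sub>Q / ((1 - \<epsilon>) * m + \<epsilon> * m\<^sub>Q)) * measure (posterior f K Pr\<^sub>\<Psi> x) A
        + \<epsilon> * m\<^sub>Q / ((1 - \<epsilon>) * m + \<epsilon> * m\<^sub>Q) * measure (posterior f K Q x) A"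
      using g assms(7,9,11) sets \<epsilon> c A_sets
      unfolding m_def m\<^sub>Q_def by (intro posterior_mixture) auto
    finally have "strength f K ?M x \<psi>\<^sub>0 - strength f K Pr\<^sub>\<Psi> x \<psi>\<^sub>0
        = \<epsilon> * m\<^sub>Q / ((1 - \<epsilon>) * m + \<epsilon> * m\<^sub>Q) * d"
      by (simp only: strength_def A_def[symmetric] d_def ring_distribs)
    then show ?thesis
      using \<epsilon> by (simp add: marginal)
  qed

  have "((\<lambda>\<epsilon>. m\<^sub>Q / ((1 - \<epsilon>) * m + \<epsilon> * m\<^sub>Q) * d) \<longlongrightarrow> m\<^sub>Q / ((1 - 0) * m + 0 * m\<^sub>Q) * d) (at_right 0)"
    using m by (intro tendsto_intros) auto
  moreover have "\<forall>\<^sub>F \<epsilon> in at_right 0. m\<^sub>Q / ((1 - \<epsilon>) * m + \<epsilon> * m\<^sub>Q) * d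
      = (strength f K (marginal \<Psi> \<nu>\<^sub>\<Psi> (perturbed_prior \<Psi> \<nu>\<^sub>\<Psi> K Pr Q \<epsilon>)) x \<psi>\<^sub>0
        - strength f K Pr\<^sub>\<Psi> x \<psi>\<^sub>0) / \<epsilon>"
    using eventually_at_right_real[of "0 :: real" 1]
    by (auto elim!: eventually_mono simp: quotient)
  ultimately have "((\<lambda>\<epsilon>. (strength f K (marginal \<Psi> \<nu>\<^sub>\<Psi> (perturbed_prior \<Psi> \<nu>\<^sub>\<Psi> K Pr Q \<epsilon>)) x \<psi>\<^sub>0
      - strength f K Pr\<^sub>\<Psi> x \<psi>\<^sub>0) / \<epsilon>) \<longlongrightarrow> m\<^sub>Q / m * d) (at_right 0)"
    by (auto intro: Lim_transform_eventually)
  then show ?thesis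
    by (simp add: m_def m\<^sub>Q_def d_def A_def strength_def)
qed

end
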